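(* Let $p$ be a prime number. Then $$|\nu_{p^k,Z(\mathbb{Z}_{p^k})}| = |\nu_{p^{k-1}}| - k +1$$ for every integer $k\geq 2$. In the case $k=1$, $|\nu_{p,Z(\mathbb{Z}_{p})}| = 0$.
   Context: For a positive integer $n$, elements of $\mathbb{Z}_n$ are identified with their representatives $0,1,\dots,n-1$. An unordered pair $\{a,b\}$ with $0\le a,b<n$ ($a=b$ allowed) is called a gcd-pair in $\mathbb{Z}_n$ if $\gcd(a,b)$ divides $n$. Here $\gcd(0,a)=a$ and $\gcd(0,0)=0$, so $\{0,0\}$ is not a gcd-pair. $\nu_n$ denotes the set of all gcd-pairs in $\mathbb{Z}_n$, and for $A\subseteq\mathbb{Z}_n$, $\nu_{n,A}$ denotes the set of those gcd-pairs $\{a,b\}\in\nu_n$ with $a,b\in A$. $Z(\mathbb{Z}_n)$ denotes the set of zero divisors of $\mathbb{Z}_n$, where the zero element is not counted as a zero divisor. *)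

theory Defs
  imports "HOL-Number_Theory.Residues" "HOL-Library.Uprod"
begin

text \<open>
  The ring of integers modulo \<open>n\<close> is \<^term>\<open>residue_ring (int n)\<close>, whose carrier
  consists of the representatives \<open>0, \<dots>, n - 1\<close>. One-sided annihilation suffices
  below because only commutative rings are considered.
\<close>

definition zero_divisors :: "('a, 'b) ring_scheme \<Rightarrow> 'a set" where
  "zero_divisors R =
     {x \<in> carrier R. x \<noteq> \<zero>\<^bsub>R\<^esub> \<and> (\<exists>y \<in> carrier R. y \<noteq> \<zero>\<^bsub>R\<^esub> \<and> x \<otimes>\<^bsub>R\<^esub> y = \<zero>\<^bsub>R\<^esub>)}"

text \<open>
  The gcd is that of the integer representatives, so \<open>Upair 0 0\<close> is excluded
  for positive \<open>n\<close>: its gcd is \<open>0\<close>, which does not divide \<open>n\<close>.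
\<close>

definition gcd_pairs :: "nat \<Rightarrow> int uprod set" where
  "gcd_pairs n =
     {Upair a b | a b. a \<in> carrier (residue_ring (int n)) \<and>
                       b \<in> carrier (residue_ring (int n)) \<and> gcd a b dvd int n}"

definition gcd_pairs_in :: "nat \<Rightarrow> int set \<Rightarrow> int uprod set" where
  "gcd_pairs_in n A = {P \<in> gcd_pairs n. set_uprod P \<subseteq> A}"

lemma finite_gcd_pairs: "finite (gcd_pairs n)"
proof -
  have "gcd_pairs n \<subseteq> (\<lambda>(a, b). Upair a b) ` ({0..int n - 1} \<times> {0..int n - 1})"
    by (auto simp: gcd_pairs_def residue_ring_def)
  then show ?thesis
    by (rule finite_subset) simp
qed

lemma finite_gcd_pairs_in: "finite (gcd_pairs_in n A)"
  unfolding gcd_pairs_in_def by (simp add: finite_gcd_pairs)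

end

theory Submission
  imports Defs
begin

text \<open>
  The zero divisors of \<open>\<int>/p\<^sup>k\<close> are the multiples \<open>p a\<close> with \<open>0 < a < p\<^sup>k\<^sup>-\<^sup>1\<close>, and dividing by \<open>p\<close>
  turns gcd-pairs of zero divisors modulo \<open>p\<^sup>k\<close> into gcd-pairs of nonzero elements modulo
  \<open>p\<^sup>k\<^sup>-\<^sup>1\<close>. The gcd-pairs lost this way are the pairs \<open>{0, d}\<close> with \<open>d\<close> one of the \<open>k - 1\<close>
  proper divisors of \<open>p\<^sup>k\<^sup>-\<^sup>1\<close>.
\<close>

lemma zero_divisors_residue_ring:
  "zero_divisors (residue_ring m) = {x \<in> {0<..<m}. \<exists>y \<in> {0<..<m}. m dvd x * y}"
proof -
  have "x \<in> {0<..<m} \<longleftrightarrow> x \<in> {0..m - 1} \<and> x \<noteq> 0" for x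
    by auto
  then show ?thesis
    unfolding zero_divisors_def residue_ring_def Bex_def
    by (simp add: mod_eq_0_iff_dvd conj_assoc)
qed

text \<open>If \<open>p\<close> does not divide \<open>x\<close>, then \<open>x\<close> is coprime
  to \<open>p ^ Suc j\<close>, so \<open>p ^ Suc j\<close> would divide the annihilator
  \<open>y\<close>, which is positive and smaller. For \<open>j = 0\<close> the range is empty: a
  field has no zero divisors.\<close>

lemma zero_divisors_residue_ring_prime_power:
  fixes p :: int
  assumes "prime p"
  shows "zero_divisors (residue_ring (p ^ Suc j)) = (*) p ` {0<..<p ^ j}"
proof (intro equalityI subsetI)
  have p: "p > 1"
    using assms by (rule prime_gt_1_int)
  fix x assume "x \<in> zero_divisors (residue_ring (p ^ Suc j))"
  then obtain y where x: "0 < x" "x < p ^ Suc j" and y: "0 < y" "y < p ^ Suc j"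
    and xy: "p ^ Suc j dvd x * y"
    by (auto simp: zero_divisors_residue_ring)
  have "p dvd x"
  proof (rule ccontr)
    assume "\<not> p dvd x"
    then have "coprime (p ^ Suc j) x"
      using assms by (intro coprime_power_left_iff[THEN iffD2] disjI1 prime_imp_coprime)
    then have "p ^ Suc j dvd y"
      using xy by (simp only: coprime_dvd_mult_right_iff)
    with y show False
      using zdvd_imp_le by fastforce
  qed
  then obtain a where "x = p * a" ..
  with x p show "x \<in> (*) p ` {0<..<p ^ j}"
    by (auto simp: zero_less_mult_iff)
next
  have p: "p > 1"
    using assms by (rule prime_gt_1_int)
  fix x assume "x \<in> (*) p ` {0<..<p ^ j}"
  \<comment> \<open>The annihilator of \<open>p * a\<close> is \<open>p ^ j\<close>, since their
    product is \<open>p ^ Suc j * a\<close>.\<close>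
  then show "x \<in> zero_divisors (residue_ring (p ^ Suc j))"
    using p by (auto simp: zero_divisors_residue_ring intro!: bexI[of _ "p ^ j"])
qed

text \<open>The definition only asks for some ordering of the pair; by symmetry of the gcd, any
  ordering can be tested.\<close>

lemma Upair_mem_gcd_pairs [simp]:
  "Upair a b \<in> gcd_pairs n \<longleftrightarrow> a \<in> {0..<int n} \<and> b \<in> {0..<int n} \<and> gcd a b dvd int n"
  by (auto simp: gcd_pairs_def residue_ring_def gcd.commute)

lemma Upair_mem_gcd_pairs_in [simp]:
  "Upair a b \<in> gcd_pairs_in n A \<longleftrightarrow>
     a \<in> A \<inter> {0..<int n} \<and> b \<in> A \<inter> {0..<int n} \<and> gcd a b dvd int n"
  by (auto simp: gcd_pairs_in_def)

text \<open>Multiplying both entries by \<open>c\<close> multiplies their gcd by \<open>c\<close>,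
  and \<open>c * g\<close> divides \<open>c * m\<close> exactly when \<open>g\<close> divides
  \<open>m\<close>. So entrywise multiplication is a bijection between the two sets.\<close>

lemma card_gcd_pairs_in_times:
  assumes "c > 0"
  shows "card (gcd_pairs_in (c * m) ((*) (int c) ` {0<..<int m})) =
         card (gcd_pairs_in m {0<..<int m})"
proof -
  let ?f = "map_uprod ((*) (int c))"
  have "gcd_pairs_in (c * m) ((*) (int c) ` {0<..<int m}) = ?f ` gcd_pairs_in m {0<..<int m}"
  proof (intro equalityI subsetI)
    fix P assume P: "P \<in> gcd_pairs_in (c * m) ((*) (int c) ` {0<..<int m})"
    obtain x y where xy: "P = Upair x y"
      by (cases P)
    with P have "x \<in> (*) (int c) ` {0<..<int m}" "y \<in> (*) (int c) ` {0<..<int m}"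
      by simp_all
    then obtain a b where "x = int c * a" "y = int c * b"
      and "a \<in> {0<..<int m}" "b \<in> {0<..<int m}"
      by blast
    then have "P = ?f (Upair a b)" "Upair a b \<in> gcd_pairs_in m {0<..<int m}"
      using P xy assms by (auto simp: gcd_mult_distrib_int[symmetric])
    then show "P \<in> ?f ` gcd_pairs_in m {0<..<int m}"
      by (rule image_eqI)
  next
    fix P assume "P \<in> ?f ` gcd_pairs_in m {0<..<int m}"
    then obtain Q where Q: "Q \<in> gcd_pairs_in m {0<..<int m}" "P = ?f Q" ..
    obtain a b where "Q = Upair a b"
      by (cases Q)
    with Q assms show "P \<in> gcd_pairs_in (c * m) ((*) (int c) ` {0<..<int m})"
      by (auto simp: gcd_mult_distrib_int[symmetric])
  qed
  moreover have "inj ?f"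
    using assms by (intro uprod.inj_map) (simp add: inj_def)
  ultimately show ?thesis
    by (simp add: card_image inj_on_subset)
qed

text \<open>The second summand counts the gcd-pairs containing 0: as \<open>gcd 0 d = d\<close>, the
  partner \<open>d\<close> must divide \<open>m\<close>, and being a representative it is less than
  \<open>m\<close>.\<close>

lemma card_gcd_pairs:
  assumes "m > 0"
  shows "card (gcd_pairs m) =
         card (gcd_pairs_in m {0<..<int m}) + card {d \<in> {0<..<int m}. d dvd int m}"
proof -
  let ?D = "{d \<in> {0<..<int m}. d dvd int m}"
  have inj: "inj (Upair (0 :: int))"
    by (simp add: inj_def)
  \<comment> \<open>For \<open>d = 0\<close> both sides are false, because 0 does not divide
    \<open>m > 0\<close>. Otherwise the entry 0 rules out \<open>gcd_pairs_in\<close>, leaving only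
    the image of \<open>?D\<close>.\<close>
  have zero: "Upair 0 d \<in> gcd_pairs m \<longleftrightarrow>
      Upair 0 d \<in> gcd_pairs_in m {0<..<int m} \<union> Upair 0 ` ?D" for d
    using assms by (cases "d = 0") (auto simp: inj_image_mem_iff[OF inj])
  have "gcd_pairs m = gcd_pairs_in m {0<..<int m} \<union> Upair 0 ` ?D"
  proof (rule Set.set_eqI)
    fix P :: "int uprod"
    obtain a b where P: "P = Upair a b"
      by (cases P)
    \<comment> \<open>Pairs are unordered, so a zero in either position can be moved to the front,
      where \<open>zero\<close> applies.\<close>
    consider "P = Upair 0 a" | "P = Upair 0 b" | "a \<noteq> 0" "b \<noteq> 0"
      using P by fastforce
    then show "P \<in> gcd_pairs m \<longleftrightarrow> P \<in> gcd_pairs_in m {0<..<int m} \<union> Upair 0 ` ?D"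
    proof cases
      case 3
      then show ?thesis
        by (auto simp: P)
    qed (simp_all only: zero)
  qed
  moreover have "gcd_pairs_in m {0<..<int m} \<inter> Upair 0 ` ?D = {}"
    by (auto simp: gcd_pairs_in_def)
  moreover have "finite ?D"
    by (rule finite_subset[of _ "{0<..<int m}"]) auto
  moreover have "card (Upair 0 ` ?D) = card ?D"
    by (rule card_image[OF inj_on_subset[OF inj subset_UNIV]])
  ultimately show ?thesis
    by (simp add: card_Un_disjoint finite_gcd_pairs_in)
qed

text \<open>The proper divisors are the powers \<open>p ^ i\<close> with \<open>i < j\<close>,
  distinct because \<open>p > 1\<close>.\<close>

lemma card_proper_divisors_prime_power:
  fixes p :: int
  assumes "prime p"
  shows "card {d \<in> {0<..<p ^ j}. d dvd p ^ j} = j"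
proof -
  have p: "p > 1"
    using assms by (rule prime_gt_1_int)
  have "{d \<in> {0<..<p ^ j}. d dvd p ^ j} = (\<lambda>i. p ^ i) ` {..<j}"
  proof (intro equalityI subsetI)
    fix d assume "d \<in> {d \<in> {0<..<p ^ j}. d dvd p ^ j}"
    then have d: "0 < d" "d < p ^ j" "d dvd p ^ j" by auto
    then obtain i where i: "d = p ^ i"
      using divides_primepow[OF assms, of d j] by auto
    with d p show "d \<in> (\<lambda>i. p ^ i) ` {..<j}"
      by auto
  next
    fix d assume "d \<in> (\<lambda>i. p ^ i) ` {..<j}"
    then show "d \<in> {d \<in> {0<..<p ^ j}. d dvd p ^ j}"
      using p by (auto simp: le_imp_power_dvd)
  qed
  moreover have "inj_on (\<lambda>i. p ^ i) {..<j}"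
    using p by (simp add: inj_on_def)
  ultimately show ?thesis
    by (simp add: card_image)
qed

theorem corollary3p10:
  fixes p :: nat
  assumes "prime p"
  shows "(\<forall>k::nat. k \<ge> 2 \<longrightarrow>
            int (card (gcd_pairs_in (p ^ k) (zero_divisors (residue_ring (int (p ^ k)))))) =
            int (card (gcd_pairs (p ^ (k - 1)))) - int k + 1)
         \<and> card (gcd_pairs_in p (zero_divisors (residue_ring (int p)))) = 0"
proof (intro conjI allI impI)
  have p: "p > 0" "prime (int p)"
    using assms by (simp_all add: prime_gt_0_nat)
  \<comment> \<open>Here \<open>j\<close> is arbitrary: \<open>j = 0\<close> serves the case
    \<open>k = 1\<close>, and \<open>j = k - 1\<close> the general one.\<close>
  have *: "card (gcd_pairs_in (p ^ Suc j) (zero_divisors (residue_ring (int (p ^ Suc j))))) =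
           card (gcd_pairs_in (p ^ j) {0<..<int (p ^ j)})" for j
    using zero_divisors_residue_ring_prime_power[OF p(2), of j]
      card_gcd_pairs_in_times[OF p(1), of "p ^ j"] by simp
  show "card (gcd_pairs_in p (zero_divisors (residue_ring (int p)))) = 0"
  proof -
    \<comment> \<open>Since \<open>p ^ 0 = 1\<close>, no integer lies strictly between the
      bounds.\<close>
    have "P \<notin> gcd_pairs_in (p ^ 0) {0<..<int (p ^ 0)}" for P
      by (cases P) auto
    then have "gcd_pairs_in (p ^ 0) {0<..<int (p ^ 0)} = {}"
      by blast
    then show ?thesis
      using *[of 0] by simp
  qed
  fix k :: nat assume "k \<ge> 2"
  then obtain j where k: "k = Suc j"
    by (cases k) auto
  \<comment> \<open>The summand \<open>j = k - 1\<close> counts the proper divisors and becomes the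
    correction \<open>- int k + 1\<close>.\<close>
  have "card (gcd_pairs (p ^ j)) = card (gcd_pairs_in (p ^ j) {0<..<int (p ^ j)}) + j"
    using card_gcd_pairs[of "p ^ j"] card_proper_divisors_prime_power[OF p(2), of j] p(1)
    by simp
  then show "int (card (gcd_pairs_in (p ^ k) (zero_divisors (residue_ring (int (p ^ k)))))) =
             int (card (gcd_pairs (p ^ (k - 1)))) - int k + 1"
    unfolding k * by simp
qed

end
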